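(* Let $A$ be a null-filiform Leibniz algebra of dimension $n$, i.e. $A=NF_n$ with basis $\{e_1,\dots,e_n\}$ and products $e_ie_1=e_{i+1}$ for $1\le i\le n-1$ (other products of basis elements zero). Then any abelian group grading of $A$ is equivalent to only one of the following gradings: (I) The trivial grading $A=\langle e_1,e_2,\dots,e_n\rangle$. (II) The $\mathbb{Z}$-grading $A=\langle e_1\rangle_1\oplus\langle e_2\rangle_2\oplus\cdots\oplus\langle e_n\rangle_n$. (III) For any $2\le i\le n-1$, the $\mathbb{Z}_i$-grading $A=A_{\overline 0}\oplus A_{\overline 1}\oplus\cdots\oplus A_{\overline{i-1}}$ with $A_{\overline s}=\langle e_j : 1\le j\le n,\ j\equiv s \pmod i\rangle$ for $0\le s\le i-1$.
   Context: All algebras are over $\mathbb{C}$. A Leibniz algebra is a vector space with a bilinear multiplication satisfying $x(yz)=(xy)z-(xz)y$. With $L^1=L$, $L^{k+1}=L^kL$, an $n$-dimensional Leibniz algebra $L$ is null-filiform if $\dim L^i=n+1-i$ for $1\le i\le n+1$; it is known that every such (complex, non-Lie) algebra is isomorphic to the algebra $NF_n$ displayed in the claim. For a group $G$ (written additively), a $G$-grading of an algebra $L$ is a decomposition $L=\bigoplus_{g\in G}L_g$ with $L_gL_h\subset L_{g+h}$; its support is $\{g: L_g\ne 0\}$. The grading groups are abelian and generated by the support. $\langle v_1,\dots,v_k\rangle_g$ denotes the homogeneous subspace of degree $g$, spanned by $v_1,\dots,v_k$; unlisted homogeneous subspaces are zero. Two gradings of $L$ are equivalent if there are a bijection $\sigma$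 between their supports and an algebra automorphism $\varphi$ of $L$ with $\varphi(L_g)=L_{\sigma(g)}$ for every $g$ in the first support (where $L_{\sigma(g)}$ is the component of the second grading).
   Formalization: "Only one" is asserted for n ≥ 2 only; for n = 1 the trivial grading (I) and the Z-grading (II) of the one-dimensional algebra are equivalent, so uniqueness fails there, and for n = 1 only equivalence to some listed grading is stated. *)

theory Defs
  imports Complex_Main "HOL-Algebra.Elementary_Groups"
begin

text \<open>
  The underlying space of an algebra is a whole type, with scalar multiplication \<open>scale\<close>; grading
  groups are HOL-Algebra groups, written multiplicatively there, so that the integers and
  the integers modulo a variable number can occur in one list of gradings.
\<close>

locale complex_algebra = vector_space scale
  for scale :: "complex \<Rightarrow> 'a::ab_group_add \<Rightarrow> 'a" +
  fixes mul :: "'a \<Rightarrow> 'a \<Rightarrow> 'a"  (infixl \<open>\<bullet>\<close> 70)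
  assumes linear_mul_right: "\<And>x. Vector_Spaces.linear scale scale (\<lambda>y. x \<bullet> y)"
    and linear_mul_left: "\<And>y. Vector_Spaces.linear scale scale (\<lambda>x. x \<bullet> y)"
begin

definition automorphism :: "('a \<Rightarrow> 'a) \<Rightarrow> bool"
  where "automorphism \<phi> \<longleftrightarrow>
    Vector_Spaces.linear scale scale \<phi> \<and> bij \<phi> \<and> (\<forall>x y. \<phi> (x \<bullet> y) = \<phi> x \<bullet> \<phi> y)"

text \<open>
  Direct sum decomposition over a possibly infinite index set: every element is in exactly one
  way a sum of finitely many nonzero components. Only the values of \<open>\<Gamma>\<close> on \<open>I\<close> matter.
\<close>

definition direct_sum_decomposition :: "'i set \<Rightarrow> ('i \<Rightarrow> 'a set) \<Rightarrow> bool"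
  where "direct_sum_decomposition I \<Gamma> \<longleftrightarrow>
    (\<forall>i\<in>I. subspace (\<Gamma> i)) \<and>
    (\<forall>x. \<exists>!f. (\<forall>i\<in>I. f i \<in> \<Gamma> i) \<and> (\<forall>i. i \<notin> I \<longrightarrow> f i = 0) \<and>
              finite {i. f i \<noteq> 0} \<and> x = (\<Sum>i | f i \<noteq> 0. f i))"

definition grading :: "'g monoid \<Rightarrow> ('g \<Rightarrow> 'a set) \<Rightarrow> bool"
  where "grading G \<Gamma> \<longleftrightarrow>
    group G \<and> direct_sum_decomposition (carrier G) \<Gamma> \<and>
    (\<forall>g\<in>carrier G. \<forall>h\<in>carrier G. \<forall>x\<in>\<Gamma> g. \<forall>y\<in>\<Gamma> h. x \<bullet> y \<in> \<Gamma> (g \<otimes>\<^bsub>G\<^esub> h))"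

definition support :: "'g monoid \<Rightarrow> ('g \<Rightarrow> 'a set) \<Rightarrow> 'g set"
  where "support G \<Gamma> = {g \<in> carrier G. \<Gamma> g \<noteq> {0}}"

definition abelian_grading :: "'g monoid \<Rightarrow> ('g \<Rightarrow> 'a set) \<Rightarrow> bool"
  where "abelian_grading G \<Gamma> \<longleftrightarrow>
    comm_group G \<and> grading G \<Gamma> \<and> generate G (support G \<Gamma>) = carrier G"

definition equivalent_gradings ::
    "'g monoid \<Rightarrow> ('g \<Rightarrow> 'a set) \<Rightarrow> 'h monoid \<Rightarrow> ('h \<Rightarrow> 'a set) \<Rightarrow> bool"
  where "equivalent_gradings G \<Gamma> H \<Delta> \<longleftrightarrow>
    (\<exists>\<sigma> \<phi>. bij_betw \<sigma> (support G \<Gamma>) (support H \<Delta>) \<and> automorphism \<phi> \<and>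
           (\<forall>g\<in>support G \<Gamma>. \<phi> ` \<Gamma> g = \<Delta> (\<sigma> g)))"

text \<open>
  \<open>lower_power k\<close> is $L^k$ for $k \ge 1$, where $L^1 = L$ and $L^{k+1}$ is the span of the products
  of elements of $L^k$ with elements of $L$. The value at \<open>0\<close> is a dummy.
\<close>

primrec lower_power :: "nat \<Rightarrow> 'a set"
  where
    "lower_power 0 = UNIV"
  | "lower_power (Suc k) = (if k = 0 then UNIV else span {x \<bullet> y | x y. x \<in> lower_power k})"

definition null_filiform :: "nat \<Rightarrow> bool"
  where "null_filiform n \<longleftrightarrow> (\<forall>i\<in>{1..n + 1}. dim (lower_power i) = n + 1 - i)"

text \<open>\<open>e 1, \<dots>, e n\<close> is a basis with the multiplication table of $NF_n$; other values of \<open>e\<close>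
  are irrelevant. An algebra with such a basis is automatically Leibniz and null-filiform.\<close>

definition NF_basis :: "nat \<Rightarrow> (nat \<Rightarrow> 'a) \<Rightarrow> bool"
  where "NF_basis n e \<longleftrightarrow>
    inj_on e {1..n} \<and> independent (e ` {1..n}) \<and> span (e ` {1..n}) = UNIV \<and>
    (\<forall>i\<in>{1..n}. \<forall>j\<in>{1..n}. e i \<bullet> e j = (if j = 1 \<and> i \<le> n - 1 then e (i + 1) else 0))"

definition NF_trivial :: "nat \<Rightarrow> (nat \<Rightarrow> 'a) \<Rightarrow> int \<Rightarrow> 'a set"
  where "NF_trivial n e s = (if s = 0 then span (e ` {1..n}) else {0})"

definition NF_integer :: "nat \<Rightarrow> (nat \<Rightarrow> 'a) \<Rightarrow> int \<Rightarrow> 'a set"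
  where "NF_integer n e s = span {e j | j. 1 \<le> j \<and> j \<le> n \<and> int j = s}"

definition NF_mod :: "nat \<Rightarrow> (nat \<Rightarrow> 'a) \<Rightarrow> nat \<Rightarrow> int \<Rightarrow> 'a set"
  where "NF_mod n e i s = span {e j | j. 1 \<le> j \<and> j \<le> n \<and> int j mod int i = s}"

definition NF_gradings :: "nat \<Rightarrow> (nat \<Rightarrow> 'a) \<Rightarrow> (int monoid \<times> (int \<Rightarrow> 'a set)) set"
  where "NF_gradings n e =
    {(singleton_group 0, NF_trivial n e), (integer_group, NF_integer n e)} \<union>
    {(integer_mod_group i, NF_mod n e i) | i. 2 \<le> i \<and> i \<le> n - 1}"

end

locale leibniz_algebra = complex_algebra +
  assumes leibniz_identity: "x \<bullet> (y \<bullet> z) = (x \<bullet> y) \<bullet> z - (x \<bullet> z) \<bullet> y"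

end

theory Submission
  imports Defs "HOL-Algebra.Multiplicative_Group"
begin

text \<open>
  Some homogeneous component, of degree \<open>g\<close> say, contains an element \<open>x\<close> with nonzero
  \<open>e\<^sub>1\<close>-coordinate. The powers \<open>x, x x, (x x) x, \<dots>\<close> form a basis with the same multiplication
  table as \<open>e\<close>, and they are homogeneous of degrees \<open>g, g\<^sup>2, \<dots>, g\<^sup>n\<close>. Hence the grading is determined up
  to an automorphism by which of these powers coincide, i.e. by the order of \<open>g\<close>: order \<open>1\<close> gives (I),
  order \<open>i\<close> with \<open>2 \<le> i \<le> n - 1\<close> gives (III), and in all other cases the powers are distinct, which
  gives (II). The listed gradings are pairwise inequivalent because their supports have the different sizes
  \<open>1\<close>, \<open>i\<close> and \<open>n\<close>.
\<close>

context complex_algebra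
begin

notation scale (infixr \<open>*s\<close> 75)

subsection \<open>Decompositions along a labelled basis\<close>

text \<open>The linear half of \<open>NF_basis\<close>, split off so that decompositions can be
  treated without reference to the multiplication table.\<close>

definition indexed_basis :: "nat \<Rightarrow> (nat \<Rightarrow> 'a) \<Rightarrow> bool"
  where "indexed_basis n e \<longleftrightarrow>
    inj_on e {1..n} \<and> independent (e ` {1..n}) \<and> span (e ` {1..n}) = UNIV"

definition coord :: "nat \<Rightarrow> (nat \<Rightarrow> 'a) \<Rightarrow> nat \<Rightarrow> 'a \<Rightarrow> complex"
  where "coord n e j x = representation (e ` {1..n}) x (e j)"

text \<open>The common normal form of all gradings below: \<open>d j\<close> is the degree assigned
  to \<open>e j\<close>. The listed gradings use the labels \<open>0\<close>, \<open>int j\<close>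
  and \<open>int j mod int i\<close>.\<close>

definition labelled_component :: "nat \<Rightarrow> (nat \<Rightarrow> 'a) \<Rightarrow> (nat \<Rightarrow> 'i) \<Rightarrow> 'i \<Rightarrow> 'a set"
  where "labelled_component n e d i = span (e ` {j \<in> {1..n}. d j = i})"

section \<open>Coordinates with respect to an indexed basis\<close>

lemma coord_sum:
  "indexed_basis n e \<Longrightarrow> coord n e j (sum f A) = (\<Sum>i\<in>A. coord n e j (f i))"
  unfolding coord_def indexed_basis_def by (simp add: representation_sum)

lemma coord_basis:
  assumes "indexed_basis n e" "j \<in> {1..n}" "k \<in> {1..n}"
  shows "coord n e j (e k) = (if j = k then 1 else 0)"
  using assms unfolding coord_def indexed_basis_def
  by (auto simp: representation_basis dest: inj_onD)

lemma sum_coord: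
  assumes "indexed_basis n e"
  shows "(\<Sum>j\<in>{1..n}. coord n e j x *s e j) = x"
proof -
  have "(\<Sum>b\<in>e ` {1..n}. scale (representation (e ` {1..n}) x b) b) = x"
    using assms unfolding indexed_basis_def by (intro sum_representation_eq) auto
  then show ?thesis
    using assms unfolding indexed_basis_def coord_def by (simp add: sum.reindex)
qed

lemma coord_span_eq_0:
  assumes e: "indexed_basis n e" and "x \<in> span (e ` S)" "S \<subseteq> {1..n}" "j \<in> {1..n}" "j \<notin> S"
  shows "coord n e j x = 0"
proof (rule ccontr)
  assume "coord n e j x \<noteq> 0"
  moreover have "representation (e ` {1..n}) x = representation (e ` S) x"
    using assms unfolding indexed_basis_def by (intro representation_extend) auto
  ultimately have "e j \<in> e ` S"
    unfolding coord_def using representation_ne_zero by auto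
  then show False
    using assms unfolding indexed_basis_def by (auto dest: inj_onD)
qed

lemma basis_in_labelled_component: "j \<in> {1..n} \<Longrightarrow> e j \<in> labelled_component n e d (d j)"
  unfolding labelled_component_def by (auto intro: span_base)

lemma coord_labelled_component_eq_0:
  assumes "indexed_basis n e" "x \<in> labelled_component n e d i" "j \<in> {1..n}" "d j \<noteq> i"
  shows "coord n e j x = 0"
  using assms unfolding labelled_component_def by (intro coord_span_eq_0) auto

lemma labelled_component_coords:
  assumes e: "indexed_basis n e" and x: "x \<in> labelled_component n e d i"
  shows "x = (\<Sum>j | j \<in> {1..n} \<and> d j = i. coord n e j x *s e j)"
proof -
  have "(\<Sum>j | j \<in> {1..n} \<and> d j = i. coord n e j x *s e j)
      = (\<Sum>j\<in>{1..n}. coord n e j x *s e j)"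
    using coord_labelled_component_eq_0[OF e x] by (intro sum.mono_neutral_left) auto
  with sum_coord[OF e] show ?thesis by simp
qed

lemma sum_coord_by_label:
  fixes d :: "nat \<Rightarrow> 'i"
  assumes e: "indexed_basis n e"
  defines "f \<equiv> \<lambda>x i. \<Sum>j | j \<in> {1..n} \<and> d j = i. coord n e j x *s e j"
  shows "{i. f x i \<noteq> 0} \<subseteq> d ` {1..n}" "(\<Sum>i | f x i \<noteq> 0. f x i) = x"
proof -
  show sub: "{i. f x i \<noteq> 0} \<subseteq> d ` {1..n}"
  proof
    fix i assume "i \<in> {i. f x i \<noteq> 0}"
    then have "{j. j \<in> {1..n} \<and> d j = i} \<noteq> {}"
      unfolding f_def by (metis (mono_tags, lifting) mem_Collect_eq sum.empty)
    then show "i \<in> d ` {1..n}" by auto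
  qed
  have "(\<Sum>i | f x i \<noteq> 0. f x i) = (\<Sum>i\<in>d ` {1..n}. f x i)"
    using sub by (intro sum.mono_neutral_left) auto
  also have "\<dots> = (\<Sum>j\<in>{1..n}. coord n e j x *s e j)"
    unfolding f_def by (rule sum.group) auto
  finally show "(\<Sum>i | f x i \<noteq> 0. f x i) = x"
    using sum_coord[OF e] by simp
qed

text \<open>Existence comes from grouping coordinates by label. For uniqueness, the
  \<open>e j\<close>-coordinate of \<open>x\<close> can only come from the summand with label
  \<open>d j\<close>, so all coordinates of every summand are determined by
  \<open>x\<close>.\<close>

lemma direct_sum_labelled_component:
  assumes e: "indexed_basis n e" and d: "d ` {1..n} \<subseteq> I"
  shows "direct_sum_decomposition I (labelled_component n e d)"
  unfolding direct_sum_decomposition_def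
proof (intro conjI ballI allI)
  show "subspace (labelled_component n e d i)" for i
    unfolding labelled_component_def by simp
  fix x
  define f where "f i = (\<Sum>j | j \<in> {1..n} \<and> d j = i. coord n e j x *s e j)" for i
  note f = sum_coord_by_label[OF e, where d = d and x = x, folded f_def]
  show "\<exists>!f. (\<forall>i\<in>I. f i \<in> labelled_component n e d i) \<and> (\<forall>i. i \<notin> I \<longrightarrow> f i = 0) \<and>
      finite {i. f i \<noteq> 0} \<and> x = (\<Sum>i | f i \<noteq> 0. f i)"
  proof (rule ex1I[of _ f], intro conjI ballI allI impI)
    show "f i \<in> labelled_component n e d i" for i
      unfolding f_def labelled_component_def
      by (intro span_sum span_scale span_base) auto
    show "f i = 0" if "i \<notin> I" for i
      using that f(1) d by auto
    show "finite {i. f i \<noteq> 0}"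
      using f(1) finite_subset by blast
    show "x = (\<Sum>i | f i \<noteq> 0. f i)"
      using f(2) by simp
  next
    fix h
    assume "(\<forall>i\<in>I. h i \<in> labelled_component n e d i) \<and> (\<forall>i. i \<notin> I \<longrightarrow> h i = 0) \<and>
      finite {i. h i \<noteq> 0} \<and> x = (\<Sum>i | h i \<noteq> 0. h i)"
    then have h: "\<And>i. i \<in> I \<Longrightarrow> h i \<in> labelled_component n e d i" "\<And>i. i \<notin> I \<Longrightarrow> h i = 0"
      and fin: "finite {i. h i \<noteq> 0}" and x: "x = (\<Sum>i | h i \<noteq> 0. h i)"
      by auto
    have mem: "h i \<in> labelled_component n e d i" for i
      using h by (cases "i \<in> I") (auto simp: labelled_component_def span_zero)
    have coord_x: "coord n e j x = coord n e j (h (d j))" if j: "j \<in> {1..n}" for j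
    proof -
      have "coord n e j (h i) = 0" if "i \<noteq> d j" for i
        using coord_labelled_component_eq_0[OF e mem j] that by auto
      \<comment> \<open>Intersecting with \<open>{d j}\<close> also covers
        \<open>h (d j) = 0\<close>, where the sum is empty and the coordinate vanishes.\<close>
      then have "coord n e j x = (\<Sum>i\<in>{i. h i \<noteq> 0} \<inter> {d j}. coord n e j (h i))"
        unfolding x coord_sum[OF e] using fin by (intro sum.mono_neutral_right) auto
      also have "\<dots> = coord n e j (h (d j))"
        by (cases "h (d j) = 0") (auto simp: coord_def representation_zero)
      finally show ?thesis .
    qed
    have "h i = f i" for i
      unfolding f_def using coord_x
      by (subst labelled_component_coords[OF e mem]) (auto intro!: sum.cong)
    then show "h = f" ..
  qed
qed

text \<open>A basis of homogeneous elements determines the whole decomposition. The nontrivial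
  inclusion compares two decompositions of \<open>x\<close> in \<Gamma> \<open>i\<close>, the
  grouping by labels and the one concentrated at \<open>i\<close>; uniqueness makes them
  equal.\<close>

lemma component_eq_labelled_component:
  assumes e: "indexed_basis n e" and \<Gamma>: "direct_sum_decomposition I \<Gamma>"
    and d: "\<And>j. j \<in> {1..n} \<Longrightarrow> d j \<in> I" and mem: "\<And>j. j \<in> {1..n} \<Longrightarrow> e j \<in> \<Gamma> (d j)"
    and i: "i \<in> I"
  shows "\<Gamma> i = labelled_component n e d i"
proof
  have sub: "subspace (\<Gamma> k)" if "k \<in> I" for k
    using \<Gamma> that unfolding direct_sum_decomposition_def by blast
  show "labelled_component n e d i \<subseteq> \<Gamma> i"
    unfolding labelled_component_def using mem sub[OF i] by (intro span_minimal) auto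
  show "\<Gamma> i \<subseteq> labelled_component n e d i"
  proof
    fix x assume x: "x \<in> \<Gamma> i"
    define f where "f i = (\<Sum>j | j \<in> {1..n} \<and> d j = i. coord n e j x *s e j)" for i
    note f = sum_coord_by_label[OF e, where d = d and x = x, folded f_def]
    define h where "h k = (if k = i then x else 0)" for k
    let ?P = "\<lambda>f. (\<forall>i\<in>I. f i \<in> \<Gamma> i) \<and> (\<forall>i. i \<notin> I \<longrightarrow> f i = 0) \<and>
      finite {i. f i \<noteq> 0} \<and> x = (\<Sum>i | f i \<noteq> 0. f i)"
    have "?P f"
    proof (intro conjI ballI allI impI)
      show "f k \<in> \<Gamma> k" if "k \<in> I" for k
        unfolding f_def using sub[OF that] mem
        by (intro subspace_sum subspace_scale) auto
      show "f k = 0" if "k \<notin> I" for k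
        using that f(1) d by auto
      show "finite {i. f i \<noteq> 0}"
        using f(1) finite_subset by blast
    qed (use f(2) in simp)
    moreover have "?P h"
    proof (intro conjI ballI allI impI)
      show "h k \<in> \<Gamma> k" if "k \<in> I" for k
        using x sub[OF that] by (auto simp: h_def subspace_0)
      have "{k. h k \<noteq> 0} \<subseteq> {i}" by (auto simp: h_def)
      then show "finite {k. h k \<noteq> 0}" using finite_subset by blast
      have "(\<Sum>k | h k \<noteq> 0. h k) = (\<Sum>k\<in>{i}. h k)"
        using \<open>{k. h k \<noteq> 0} \<subseteq> {i}\<close> by (intro sum.mono_neutral_left) auto
      then show "x = (\<Sum>k | h k \<noteq> 0. h k)" by (simp add: h_def)
    qed (use i in \<open>auto simp: h_def\<close>)
    ultimately have "f = h"
      using \<Gamma> unfolding direct_sum_decomposition_def by blast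
    then have "x = f i" by (simp add: h_def)
    then show "x \<in> labelled_component n e d i"
      unfolding f_def labelled_component_def
      by (metis (no_types, lifting) imageI span_base span_scale span_sum)
  qed
qed

lemma labelled_component_ne_0_iff:
  assumes "indexed_basis n e"
  shows "labelled_component n e d i \<noteq> {0} \<longleftrightarrow> i \<in> d ` {1..n}"
proof
  assume "i \<in> d ` {1..n}"
  then obtain j where j: "j \<in> {1..n}" "i = d j" by auto
  have "e j \<noteq> 0"
    using assms j dependent_zero unfolding indexed_basis_def by (metis imageI)
  with basis_in_labelled_component[OF j(1), of e d] j(2)
  show "labelled_component n e d i \<noteq> {0}" by auto
next
  assume "labelled_component n e d i \<noteq> {0}"
  then have "{j \<in> {1..n}. d j = i} \<noteq> {}"
    unfolding labelled_component_def by (metis image_empty span_empty)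
  then show "i \<in> d ` {1..n}" by auto
qed

lemma support_labelled_component:
  assumes e: "indexed_basis n e" and d: "d ` {1..n} \<subseteq> carrier G"
    and \<Gamma>: "\<And>g. g \<in> carrier G \<Longrightarrow> \<Gamma> g = labelled_component n e d g"
  shows "support G \<Gamma> = d ` {1..n}"
proof -
  have "support G \<Gamma> = {g \<in> carrier G. g \<in> d ` {1..n}}"
    unfolding support_def
    by (intro Collect_cong conj_cong refl) (simp only: \<Gamma> labelled_component_ne_0_iff[OF e])
  with d show ?thesis by auto
qed

subsection \<open>Null-filiform bases\<close>

lemma NF_basis_indexed: "NF_basis n e \<Longrightarrow> indexed_basis n e"
  unfolding NF_basis_def indexed_basis_def by blast

lemma NF_basis_mul:
  "NF_basis n e \<Longrightarrow> i \<in> {1..n} \<Longrightarrow> j \<in> {1..n} \<Longrightarrow>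
    e i \<bullet> e j = (if j = 1 \<and> i \<le> n - 1 then e (i + 1) else 0)"
  unfolding NF_basis_def by blast

text \<open>Every \<open>e j\<close> with \<open>j\<close> at least 2 is killed by left
  multiplication with basis vectors, so only the \<open>e 1\<close>-coordinate of the right factor
  survives.\<close>

lemma NF_basis_mul_right:
  assumes "NF_basis n e" "i \<in> {1..n}"
  shows "e i \<bullet> x = (if i \<le> n - 1 then coord n e 1 x *s e (i + 1) else 0)"
proof -
  note e = NF_basis_indexed[OF assms(1)]
  interpret m: Vector_Spaces.linear scale scale "\<lambda>y. e i \<bullet> y"
    by (rule linear_mul_right)
  have "e i \<bullet> x = (\<Sum>j\<in>{1..n}. coord n e j x *s (e i \<bullet> e j))"
    by (subst sum_coord[OF e, of x, symmetric]) (simp add: m.sum m.scale)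
  also have "\<dots> = (\<Sum>j\<in>{1..n}. if j = 1 then (if i \<le> n - 1 then coord n e 1 x *s e (i + 1) else 0) else 0)"
    using NF_basis_mul[OF assms] by (intro sum.cong refl) auto
  also have "\<dots> = (if i \<le> n - 1 then coord n e 1 x *s e (i + 1) else 0)"
    using assms(2) by (subst sum.delta) auto
  finally show ?thesis .
qed

section \<open>Right annihilator, descending filtration and powers\<close>

lemma NF_mul_eq_0:
  assumes e: "NF_basis n e" and "coord n e 1 x = 0"
  shows "y \<bullet> x = 0"
proof -
  interpret m: Vector_Spaces.linear scale scale "\<lambda>y. y \<bullet> x"
    by (rule linear_mul_left)
  have "y \<in> span (e ` {1..n})"
    using e unfolding NF_basis_def by simp
  then show ?thesis
    by (rule m.eq_0_on_span[rotated]) (use NF_basis_mul_right[OF e] assms(2) in auto)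
qed

text \<open>Right multiplication by any \<open>x\<close> rescales each \<open>e i\<close> and shifts
  its index by one, so it lowers the filtration by the tails of the basis.\<close>

lemma NF_mul_span:
  assumes e: "NF_basis n e" and "1 \<le> k" and y: "y \<in> span (e ` {k..n})"
  shows "y \<bullet> x \<in> span (e ` {Suc k..n})"
proof -
  interpret m: Vector_Spaces.linear scale scale "\<lambda>y. y \<bullet> x"
    by (rule linear_mul_left)
  have "(\<lambda>y. y \<bullet> x) ` span (e ` {k..n}) = span ((\<lambda>y. y \<bullet> x) ` e ` {k..n})"
    by (simp add: m.span_image)
  also have "\<dots> \<subseteq> span (e ` {Suc k..n})"
  proof (rule span_minimal[OF _ subspace_span], clarify)
    fix i assume i: "i \<in> {k..n}"
    have "e (i + 1) \<in> span (e ` {Suc k..n})" if "i \<le> n - 1"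
      using i that \<open>1 \<le> k\<close> by (intro span_base imageI) auto
    then show "e i \<bullet> x \<in> span (e ` {Suc k..n})"
      using NF_basis_mul_right[OF e, of i x] i \<open>1 \<le> k\<close> by (simp add: span_scale span_zero)
  qed
  finally show ?thesis using y by auto
qed

lemma coord_1_mul:
  assumes e: "NF_basis n e" and n: "1 \<le> n"
  shows "coord n e 1 (y \<bullet> x) = 0"
proof -
  have "y \<in> span (e ` {1..n})"
    using e unfolding NF_basis_def by simp
  then have "y \<bullet> x \<in> span (e ` {Suc 1..n})"
    using NF_mul_span[OF e] by simp
  then show ?thesis
    using coord_span_eq_0[OF NF_basis_indexed[OF e], of _ "{Suc 1..n}" 1] n by auto
qed

text \<open>The exponent is shifted: \<open>right_power x i\<close> has \<open>i + 1\<close> factors.\<close>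

primrec right_power :: "'a \<Rightarrow> nat \<Rightarrow> 'a"
  where
    "right_power x 0 = x"
  | "right_power x (Suc i) = right_power x i \<bullet> x"

text \<open>Powers of \<open>x\<close> are triangular with respect to \<open>e\<close>: multiplying
  the leading term by \<open>x\<close> contributes one more factor \<open>coord n e 1 x\<close>,
  while the error term moves one step down the filtration.\<close>

lemma right_power_leading:
  assumes e: "NF_basis n e" and "i < n"
  shows "right_power x i - coord n e 1 x ^ Suc i *s e (Suc i) \<in> span (e ` {Suc (Suc i)..n})"
  using \<open>i < n\<close>
proof (induction i)
  case 0
  have "x = coord n e 1 x *s e 1 + (\<Sum>j\<in>{Suc 1..n}. coord n e j x *s e j)"
    using sum_coord[OF NF_basis_indexed[OF e], of x] 0 by (simp add: sum.atLeast_Suc_atMost)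
  then have "x - coord n e 1 x *s e 1 = (\<Sum>j\<in>{Suc 1..n}. coord n e j x *s e j)"
    by (metis add_diff_cancel_left')
  also have "\<dots> \<in> span (e ` {Suc 1..n})"
    by (intro span_sum span_scale span_base) auto
  finally show ?case by simp
next
  case (Suc i)
  interpret m: Vector_Spaces.linear scale scale "\<lambda>y. y \<bullet> x"
    by (rule linear_mul_left)
  have "e (Suc i) \<bullet> x = coord n e 1 x *s e (Suc (Suc i))"
    using NF_basis_mul_right[OF e, of "Suc i" x] Suc.prems by auto
  then have "right_power x (Suc i) - coord n e 1 x ^ Suc (Suc i) *s e (Suc (Suc i))
      = (right_power x i - coord n e 1 x ^ Suc i *s e (Suc i)) \<bullet> x"
    by (simp add: m.diff m.scale mult.commute)
  also have "\<dots> \<in> span (e ` {Suc (Suc (Suc i))..n})"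
    using Suc by (intro NF_mul_span[OF e]) auto
  finally show ?case .
qed

text \<open>The triangular system has diagonal entries \<open>coord n e 1 x ^ i\<close>, which are
  nonzero, so the powers form a basis. From the second power on they are products, hence have no
  \<open>e 1\<close>-coordinate and annihilate from the right.\<close>

lemma NF_basis_right_power:
  assumes e: "NF_basis n e" and n: "1 \<le> n" and x: "coord n e 1 x \<noteq> 0"
  shows "NF_basis n (\<lambda>i. right_power x (i - 1))"
proof -
  define f where "f i = right_power x (i - 1)" for i
  interpret m: Vector_Spaces.linear scale scale "\<lambda>y. y \<bullet> x"
    by (rule linear_mul_left)
  interpret finite_dimensional_vector_space scale "e ` {1..n}"
    using e by unfold_locales (auto simp: NF_basis_def)
  have card_e: "card (e ` {1..n}) = n"
    using e by (auto simp: NF_basis_def card_image)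
  have lead: "f i - coord n e 1 x ^ i *s e i \<in> span (e ` {Suc i..n})" if "i \<in> {1..n}" for i
    using right_power_leading[OF e, of "i - 1" x] that by (cases i) (auto simp: f_def)
  have e_mem: "e k \<in> span (f ` {1..n})" if "k \<in> {1..n}" for k
    using that
  \<comment> \<open>Back substitution from \<open>k = n\<close> downwards: the tail below
    \<open>e k\<close> is already in the span, so the leading term can be solved for
    \<open>e k\<close>.\<close>
  proof (induction "n - k" arbitrary: k rule: less_induct)
    case less
    have "span (e ` {Suc k..n}) \<subseteq> span (f ` {1..n})"
      using less by (intro span_minimal subspace_span image_subsetI) auto
    with lead[OF less.prems] have "f k - coord n e 1 x ^ k *s e k \<in> span (f ` {1..n})"
      by auto
    moreover have "f k \<in> span (f ` {1..n})"
      using less.prems by (auto intro: span_base)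
    ultimately have "f k - (f k - coord n e 1 x ^ k *s e k) \<in> span (f ` {1..n})"
      using span_diff by blast
    then have "inverse (coord n e 1 x ^ k) *s (coord n e 1 x ^ k *s e k) \<in> span (f ` {1..n})"
      by (intro span_scale[of "coord n e 1 x ^ k *s e k"]) simp
    then show ?case using x by simp
  qed
  have span_f: "span (f ` {1..n}) = UNIV"
  proof -
    have "span (e ` {1..n}) \<subseteq> span (f ` {1..n})"
      using e_mem by (intro span_minimal subspace_span) blast
    then show ?thesis unfolding span_Basis by blast
  qed
  \<comment> \<open>A spanning set with at most \<open>n\<close> elements in dimension
    \<open>n\<close> is independent. Its cardinality is then exactly \<open>n\<close>, which in turn
    gives injectivity of \<open>f\<close>.\<close>
  have indep: "independent (f ` {1..n})"
    by (rule card_le_dim_spanning[of _ UNIV]) (use span_f card_e card_image_le[of "{1..n}" f] in auto)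
  then have "card (f ` {1..n}) = n"
    using dim_span_eq_card_independent[OF indep] unfolding span_f dim_UNIV card_e by simp
  then have inj: "inj_on f {1..n}"
    by (intro eq_card_imp_inj_on) auto
  have f_Suc: "f (i + 1) = f i \<bullet> x" if "1 \<le> i" for i
    using that by (cases i) (auto simp: f_def)
  have "f i \<bullet> f j = (if j = 1 \<and> i \<le> n - 1 then f (i + 1) else 0)"
    if i: "i \<in> {1..n}" and j: "j \<in> {1..n}" for i j
  proof (cases "j = 1")
    case True
    show ?thesis
    proof (cases "i \<le> n - 1")
      case True
      with \<open>j = 1\<close> f_Suc[of i] i show ?thesis by (simp add: f_def)
    next
      case False
      then have "i = n" using i by auto
      \<comment> \<open>For \<open>i = n\<close> the tail \<open>{Suc n..n}\<close> is empty, so the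
        error term is zero.\<close>
      have "f n = coord n e 1 x ^ n *s e n"
        using lead[of n] n by simp
      moreover have "e n \<bullet> x = 0"
        using NF_basis_mul_right[OF e, of n x] n by auto
      ultimately have "f n \<bullet> x = 0"
        by (simp add: m.scale)
      moreover have "f 1 = x"
        by (simp add: f_def)
      ultimately show ?thesis
        using \<open>j = 1\<close> \<open>i = n\<close> \<open>\<not> i \<le> n - 1\<close> by simp
    qed
  next
    case False
    then have "f j = f (j - 1) \<bullet> x"
      using f_Suc[of "j - 1"] j by auto
    then have "coord n e 1 (f j) = 0"
      using coord_1_mul[OF e n] by simp
    then show ?thesis
      using NF_mul_eq_0[OF e] False by simp
  qed
  with inj indep span_f have "NF_basis n f"
    unfolding NF_basis_def by blast
  then show ?thesis unfolding f_def .
qed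

text \<open>Two bases with the same multiplication table are matched by a linear map, whose inverse
  is the map matching them the other way round. Multiplicativity holds on basis pairs and extends
  linearly in one argument at a time.\<close>

lemma NF_basis_automorphism:
  assumes f: "NF_basis n f" and e: "NF_basis n e"
  obtains \<phi> where "automorphism \<phi>" "\<And>i. i \<in> {1..n} \<Longrightarrow> \<phi> (f i) = e i"
proof -
  interpret vp: vector_space_pair scale scale ..
  \<comment> \<open>The local \<forall>-style generality in \<open>e\<close> and \<open>f\<close>
    lets the same fact supply both \<phi> and its inverse \<psi>.\<close>
  have ex: "\<exists>\<phi>. Vector_Spaces.linear scale scale \<phi> \<and> (\<forall>i\<in>{1..n}. \<phi> (f i) = e i)"
    if f: "NF_basis n f" for e f
  proof (intro exI conjI ballI)
    let ?\<phi> = "vp.construct (f ` {1..n}) (\<lambda>b. e (inv_into {1..n} f b))"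
    show "Vector_Spaces.linear scale scale ?\<phi>"
      using f unfolding NF_basis_def by (intro vp.linear_construct) blast
    show "?\<phi> (f i) = e i" if "i \<in> {1..n}" for i
      using f that unfolding NF_basis_def by (simp add: vp.construct_basis)
  qed
  from ex[OF f] obtain \<phi> where \<phi>: "Vector_Spaces.linear scale scale \<phi>"
    and \<phi>f: "\<And>i. i \<in> {1..n} \<Longrightarrow> \<phi> (f i) = e i" by blast
  from ex[OF e] obtain \<psi> where \<psi>: "Vector_Spaces.linear scale scale \<psi>"
    and \<psi>e: "\<And>i. i \<in> {1..n} \<Longrightarrow> \<psi> (e i) = f i" by blast
  have span_f: "x \<in> span (f ` {1..n})" and span_e: "x \<in> span (e ` {1..n})" for x
    using e f unfolding NF_basis_def by auto
  have "(\<psi> \<circ> \<phi>) x = id x" for x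
    by (rule vp.linear_eq_on[OF Vector_Spaces.linear_compose[OF \<phi> \<psi>] linear_id span_f])
      (use \<phi>f \<psi>e in auto)
  moreover have "(\<phi> \<circ> \<psi>) x = id x" for x
    by (rule vp.linear_eq_on[OF Vector_Spaces.linear_compose[OF \<psi> \<phi>] linear_id span_e])
      (use \<phi>f \<psi>e in auto)
  ultimately have bij: "bij \<phi>"
    by (intro o_bij[of \<psi>]) auto
  note comp = Vector_Spaces.linear_compose[unfolded comp_def]
  have basis: "\<phi> (f i \<bullet> f j) = \<phi> (f i) \<bullet> \<phi> (f j)" if ij: "i \<in> {1..n}" "j \<in> {1..n}" for i j
    using NF_basis_mul[OF f ij] NF_basis_mul[OF e ij] ij \<phi>f vp.linear_0[OF \<phi>]
    by auto
  have left: "\<phi> (f i \<bullet> y) = \<phi> (f i) \<bullet> \<phi> y" if i: "i \<in> {1..n}" for i y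
    by (rule vp.linear_eq_on[OF comp[OF linear_mul_right \<phi>] comp[OF \<phi> linear_mul_right] span_f])
      (use basis i in auto)
  have "\<phi> (x \<bullet> y) = \<phi> x \<bullet> \<phi> y" for x y
    by (rule vp.linear_eq_on[OF comp[OF linear_mul_left \<phi>] comp[OF \<phi> linear_mul_left] span_f])
      (use left in auto)
  with \<phi> bij \<phi>f that show ?thesis
    unfolding automorphism_def by blast
qed

subsection \<open>Gradings with a homogeneous null-filiform basis\<close>

text \<open>The only nonzero basis products are \<open>e j\<close> times \<open>e 1\<close>, and
  \<open>d_Suc\<close> says exactly that these have the right degree. Zero products lie in every
  component, and bilinearity does the rest.\<close>

lemma grading_labelled_component:
  assumes e: "NF_basis n e" and G: "group G" and d: "d ` {1..n} \<subseteq> carrier G"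
    and d_Suc: "\<And>j. 1 \<le> j \<Longrightarrow> j < n \<Longrightarrow> d (j + 1) = d j \<otimes>\<^bsub>G\<^esub> d 1"
  shows "grading G (labelled_component n e d)"
  unfolding grading_def
proof (intro conjI ballI G)
  show "direct_sum_decomposition (carrier G) (labelled_component n e d)"
    using e d by (intro direct_sum_labelled_component NF_basis_indexed)
  fix g h x y
  assume x: "x \<in> labelled_component n e d g" and y: "y \<in> labelled_component n e d h"
  let ?T = "labelled_component n e d (g \<otimes>\<^bsub>G\<^esub> h)"
  have sub: "subspace ?T" unfolding labelled_component_def by simp
  have basis: "e j \<bullet> e k \<in> ?T" if "j \<in> {1..n}" "k \<in> {1..n}" "d j = g" "d k = h" for j k
    using NF_basis_mul[OF e that(1,2)] that d_Suc[of j] sub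
      basis_in_labelled_component[of "j + 1" n e d] by (auto simp: subspace_0)
  have left: "e j \<bullet> y \<in> ?T" if j: "j \<in> {1..n}" "d j = g" for j
  proof -
    interpret m: Vector_Spaces.linear scale scale "\<lambda>y. e j \<bullet> y"
      by (rule linear_mul_right)
    show ?thesis
      using y unfolding labelled_component_def[of n e d h]
    proof (induction rule: span_induct)
      case base
      \<comment> \<open>The elements whose product lands in \<open>?T\<close> form the preimage of a
        subspace under a linear map, so checking spanning vectors suffices.\<close>
      show ?case using m.subspace_vimage[OF sub] by (simp add: vimage_def)
    qed (use basis j in auto)
  qed
  interpret m: Vector_Spaces.linear scale scale "\<lambda>x. x \<bullet> y"
    by (rule linear_mul_left)
  show "x \<bullet> y \<in> ?T"
    using x unfolding labelled_component_def[of n e d g]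
  proof (induction rule: span_induct)
    case base
    show ?case using m.subspace_vimage[OF sub] by (simp add: vimage_def)
  qed (use left in auto)
qed

text \<open>Up to equivalence only the partition of \<open>{1..n}\<close> into equal labels matters:
  the automorphism carries \<open>f\<close> to \<open>e\<close>, and the supports are matched by
  sending \<open>d j\<close> to \<open>d' j\<close>.\<close>

lemma equivalent_labelled_component:
  assumes f: "NF_basis n f" and e: "NF_basis n e"
    and d: "d ` {1..n} \<subseteq> carrier G" and d': "d' ` {1..n} \<subseteq> carrier H"
    and \<Gamma>: "\<And>g. g \<in> carrier G \<Longrightarrow> \<Gamma> g = labelled_component n f d g"
    and \<Delta>: "\<And>h. h \<in> carrier H \<Longrightarrow> \<Delta> h = labelled_component n e d' h"
    and dd': "\<And>j k. j \<in> {1..n} \<Longrightarrow> k \<in> {1..n} \<Longrightarrow> d j = d k \<longleftrightarrow> d' j = d' k"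
  shows "equivalent_gradings G \<Gamma> H \<Delta>"
proof -
  obtain \<phi> where \<phi>: "automorphism \<phi>" and \<phi>f: "\<And>i. i \<in> {1..n} \<Longrightarrow> \<phi> (f i) = e i"
    using NF_basis_automorphism[OF f e] by blast
  interpret \<phi>: Vector_Spaces.linear scale scale \<phi>
    using \<phi> unfolding automorphism_def by blast
  \<comment> \<open>\<open>inv_into\<close> picks some index with label \<open>g\<close>. One
    direction of \<open>dd'\<close> makes the choice irrelevant; the other makes \<sigma>
    injective.\<close>
  define \<sigma> where "\<sigma> g = d' (inv_into {1..n} d g)" for g
  have \<sigma>: "\<sigma> (d j) = d' j" if j: "j \<in> {1..n}" for j
  proof -
    have "d j \<in> d ` {1..n}" using j by blast
    then show ?thesis
      unfolding \<sigma>_def using dd'[OF inv_into_into j] f_inv_into_f by metis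
  qed
  have supp: "support G \<Gamma> = d ` {1..n}" "support H \<Delta> = d' ` {1..n}"
    using support_labelled_component[OF NF_basis_indexed] e f d d' \<Gamma> \<Delta> by metis+
  have "bij_betw \<sigma> (support G \<Gamma>) (support H \<Delta>)"
    unfolding supp bij_betw_def
  proof
    show "inj_on \<sigma> (d ` {1..n})"
      using \<sigma> dd' by (auto intro!: inj_onI)
    show "\<sigma> ` d ` {1..n} = d' ` {1..n}"
      unfolding image_image using \<sigma> by (intro image_cong) auto
  qed
  moreover have "\<phi> ` \<Gamma> g = \<Delta> (\<sigma> g)" if g: "g \<in> support G \<Gamma>" for g
  proof -
    obtain j where j: "j \<in> {1..n}" "g = d j"
      using g unfolding supp by blast
    have "\<phi> ` \<Gamma> g = span (\<phi> ` f ` {k \<in> {1..n}. d k = d j})"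
      using \<Gamma>[of g] d j by (auto simp: labelled_component_def \<phi>.span_image image_subset_iff)
    also have "\<phi> ` f ` {k \<in> {1..n}. d k = d j} = e ` {k \<in> {1..n}. d' k = d' j}"
      unfolding image_image using \<phi>f dd' j by (intro image_cong) auto
    also have "span \<dots> = \<Delta> (d' j)"
      using \<Delta>[of "d' j"] d' j by (auto simp: labelled_component_def image_subset_iff)
    finally show ?thesis using \<sigma> j by simp
  qed
  ultimately show ?thesis
    using \<phi> unfolding equivalent_gradings_def by blast
qed

lemma equivalent_gradings_card_support:
  "equivalent_gradings G \<Gamma> H \<Delta> \<Longrightarrow> card (support G \<Gamma>) = card (support H \<Delta>)"
  unfolding equivalent_gradings_def by (auto dest: bij_betw_same_card)

text \<open>The coordinate 1 of \<open>e 1\<close> along itself is the sum of those of its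
  homogeneous components, so one component has a nonzero one. Its powers are a homogeneous
  null-filiform basis, which determines the grading.\<close>

lemma grading_homogeneous_NF_basis:
  assumes e: "NF_basis n e" and n: "1 \<le> n" and \<Gamma>: "grading G \<Gamma>"
  obtains g f where "g \<in> carrier G" "NF_basis n f"
    "\<And>h. h \<in> carrier G \<Longrightarrow> \<Gamma> h = labelled_component n f (\<lambda>j. g [^]\<^bsub>G\<^esub> j) h"
proof -
  interpret group G using \<Gamma> unfolding grading_def by blast
  note basis = NF_basis_indexed[OF e]
  have dec: "direct_sum_decomposition (carrier G) \<Gamma>"
    using \<Gamma> unfolding grading_def by blast
  then obtain p where p: "\<And>i. i \<in> carrier G \<Longrightarrow> p i \<in> \<Gamma> i" "\<And>i. i \<notin> carrier G \<Longrightarrow> p i = 0"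
    and sum: "e 1 = (\<Sum>i | p i \<noteq> 0. p i)"
    unfolding direct_sum_decomposition_def by metis
  have "coord n e 1 (e 1) = 1"
    using coord_basis[OF basis, of 1 1] n by simp
  then have "(\<Sum>i | p i \<noteq> 0. coord n e 1 (p i)) \<noteq> 0"
    by (subst (asm) sum) (simp add: coord_sum[OF basis])
  then obtain g where "p g \<noteq> 0" and x: "coord n e 1 (p g) \<noteq> 0"
    by (metis (mono_tags, lifting) mem_Collect_eq sum.neutral)
  then have g: "g \<in> carrier G" and "p g \<in> \<Gamma> g"
    using p by auto
  define f where "f i = right_power (p g) (i - 1)" for i
  have f: "NF_basis n f"
    unfolding f_def using NF_basis_right_power[OF e n x] .
  have "right_power (p g) i \<in> \<Gamma> (g [^]\<^bsub>G\<^esub> Suc i)" for i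
  proof (induction i)
    case 0
    show ?case using \<open>p g \<in> \<Gamma> g\<close> g by simp
  next
    case (Suc i)
    then show ?case
      using \<Gamma> \<open>p g \<in> \<Gamma> g\<close> g unfolding grading_def
      by (metis nat_pow_Suc nat_pow_closed right_power.simps(2))
  qed
  \<comment> \<open>\<open>f j\<close> is \<open>right_power (p g) (j - 1)\<close>, a product of
    \<open>j\<close> factors, hence of degree \<open>g\<close> to the power
    \<open>j\<close>.\<close>
  then have "f j \<in> \<Gamma> (g [^]\<^bsub>G\<^esub> j)" if "j \<in> {1..n}" for j
    using that unfolding f_def by (cases j) auto
  then have "\<Gamma> h = labelled_component n f (\<lambda>j. g [^]\<^bsub>G\<^esub> j) h" if "h \<in> carrier G" for h
    using component_eq_labelled_component[OF NF_basis_indexed[OF f] dec, where d = "\<lambda>j. g [^]\<^bsub>G\<^esub> j"] g that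
    by simp
  with g f that show ?thesis by blast
qed

subsection \<open>The listed gradings\<close>

lemma NF_trivial_eq:
  "s \<in> carrier (singleton_group 0) \<Longrightarrow> NF_trivial n e s = labelled_component n e (\<lambda>_. 0) s"
  by (simp add: NF_trivial_def labelled_component_def atLeastAtMost_def atLeast_def atMost_def Int_def)

lemma NF_integer_eq: "NF_integer n e = labelled_component n e int"
  unfolding NF_integer_def labelled_component_def by (intro ext arg_cong[of _ _ span]) auto

lemma NF_mod_eq: "NF_mod n e i = labelled_component n e (\<lambda>j. int j mod int i)"
  unfolding NF_mod_def labelled_component_def by (intro ext arg_cong[of _ _ span]) auto

lemma NF_gradings_cases:
  assumes "(H, \<Delta>) \<in> NF_gradings n e"
  obtains "H = singleton_group 0" "\<Delta> = NF_trivial n e"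
  | "H = integer_group" "\<Delta> = NF_integer n e"
  | i where "2 \<le> i" "i \<le> n - 1" "H = integer_mod_group i" "\<Delta> = NF_mod n e i"
  using assms unfolding NF_gradings_def by auto

context
  fixes n e
  assumes e: "NF_basis n e" and n: "1 \<le> n"
begin

lemma support_NF_trivial: "support (singleton_group 0) (NF_trivial n e) = {0}"
  using support_labelled_component[OF NF_basis_indexed[OF e], of "\<lambda>_. 0" "singleton_group 0" "NF_trivial n e"]
    NF_trivial_eq n by (auto simp: image_constant_conv)

lemma support_NF_integer: "support integer_group (NF_integer n e) = int ` {1..n}"
  by (rule support_labelled_component[OF NF_basis_indexed[OF e]]) (auto simp: NF_integer_eq)

lemma support_NF_mod:
  assumes i: "2 \<le> i" "i \<le> n - 1"
  shows "support (integer_mod_group i) (NF_mod n e i) = {0..<int i}"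
proof -
  have "s \<in> (\<lambda>j. int j mod int i) ` {1..n}" if "s \<in> {0..<int i}" for s
  proof (cases "s = 0")
    case True
    \<comment> \<open>Indices start at 1, so the residue 0 is realised by the index \<open>i\<close>
      itself, which is at most \<open>n - 1\<close>.\<close>
    then show ?thesis using i by (intro image_eqI[of _ _ i]) auto
  next
    case False
    then show ?thesis using i that by (intro image_eqI[of _ _ "nat s"]) auto
  qed
  moreover have "support (integer_mod_group i) (NF_mod n e i) = (\<lambda>j. int j mod int i) ` {1..n}"
    by (rule support_labelled_component[OF NF_basis_indexed[OF e]])
      (use i in \<open>auto simp: NF_mod_eq carrier_integer_mod_group\<close>)
  ultimately show ?thesis using i by auto
qed

text \<open>In each case the label of \<open>e j\<close> is \<open>j\<close> times that of
  \<open>e 1\<close>. The support generates because it contains 1 in the integer case and is the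
  whole carrier otherwise.\<close>

lemma abelian_grading_NF_gradings:
  assumes "(H, \<Delta>) \<in> NF_gradings n e"
  shows "abelian_grading H \<Delta>"
  using assms
proof (cases rule: NF_gradings_cases)
  case 1
  have "grading (singleton_group 0) (labelled_component n e (\<lambda>_. 0 :: int))"
    by (rule grading_labelled_component[OF e]) (simp_all, auto simp: singleton_group_def)
  \<comment> \<open>\<open>grading\<close> inspects components only at degrees in the carrier, where
    \<open>NF_trivial_eq\<close> applies.\<close>
  then have "grading H \<Delta>"
    unfolding 1 grading_def direct_sum_decomposition_def using NF_trivial_eq[of _ n e]
    by (simp add: singleton_group_def cong: conj_cong)
  moreover have "generate H (support H \<Delta>) = carrier H"
  proof
    show "generate H (support H \<Delta>) \<subseteq> carrier H"
      unfolding 1 support_NF_trivial by (rule group.generate_incl) auto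
  qed (auto simp: 1 support_NF_trivial intro: generate.incl)
  ultimately show ?thesis
    unfolding abelian_grading_def by (simp add: 1)
next
  case 2
  have "grading H \<Delta>"
    unfolding 2 NF_integer_eq by (rule grading_labelled_component[OF e]) auto
  moreover have "generate H (support H \<Delta>) = carrier H"
  proof
    show "generate H (support H \<Delta>) \<subseteq> carrier H"
      unfolding 2 by simp
    have "generate integer_group {1} \<subseteq> generate integer_group (int ` {1..n})"
      using n by (intro group.mono_generate) force+
    moreover have "generate integer_group {1} = UNIV"
      using group.generate_pow[OF group_integer_group, of 1] by auto
    ultimately show "carrier H \<subseteq> generate H (support H \<Delta>)"
      unfolding 2 support_NF_integer by simp
  qed
  ultimately show ?thesis
    unfolding abelian_grading_def by (simp add: 2 abelian_integer_group)
next
  case (3 i)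
  have "grading H \<Delta>"
    unfolding 3 NF_mod_eq using 3(1)
    by (intro grading_labelled_component[OF e]) (auto simp: carrier_integer_mod_group mod_simps add.commute)
  moreover have "support H \<Delta> = carrier H"
    unfolding 3 support_NF_mod[OF 3(1,2)] using 3(1) by (simp add: carrier_integer_mod_group)
  moreover have "generate H (carrier H) = carrier H"
    unfolding 3 by (intro equalityI group.generate_incl) (auto intro: generate.incl)
  ultimately show ?thesis
    unfolding abelian_grading_def by (simp add: 3)
qed

section \<open>Classification and irredundancy of the list\<close>

lemma equivalent_to_NF_grading:
  assumes \<Gamma>: "grading G \<Gamma>"
  shows "\<exists>(H, \<Delta>) \<in> NF_gradings n e. equivalent_gradings G \<Gamma> H \<Delta>"
proof -
  interpret group G using \<Gamma> unfolding grading_def by blast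
  obtain g f where g: "g \<in> carrier G" and f: "NF_basis n f"
    and \<Gamma>_eq: "\<And>h. h \<in> carrier G \<Longrightarrow> \<Gamma> h = labelled_component n f (\<lambda>j. g [^]\<^bsub>G\<^esub> j) h"
    using grading_homogeneous_NF_basis[OF e n \<Gamma>] by blast
  have d: "(\<lambda>j. g [^]\<^bsub>G\<^esub> j) ` {1..n} \<subseteq> carrier G"
    using g by auto
  \<comment> \<open>This includes infinite order: then \<open>ord g = 0\<close>, and reduction
    modulo 0 is the identity.\<close>
  have pow: "g [^]\<^bsub>G\<^esub> j = g [^]\<^bsub>G\<^esub> k \<longleftrightarrow> int j mod int (ord g) = int k mod int (ord g)" for j k :: nat
    using int_pow_eq[OF g, of "int j" "int k"]
    by (metis int_pow_int mod_eq_dvd_iff)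
  note equiv = equivalent_labelled_component[OF f e d _ \<Gamma>_eq]
  \<comment> \<open>Only the exponents from 1 to \<open>n\<close> occur, so a finite order of at
    least \<open>n\<close> separates them just as infinite order does.\<close>
  consider "ord g = 1" | "2 \<le> ord g" "ord g \<le> n - 1" | "ord g = 0 \<or> n \<le> ord g"
    by linarith
  then show ?thesis
  proof cases
    case 1
    have "equivalent_gradings G \<Gamma> (singleton_group 0) (NF_trivial n e)"
      by (rule equiv[where d' = "\<lambda>_. 0"]) (use NF_trivial_eq pow 1 in auto)
    then show ?thesis unfolding NF_gradings_def by blast
  next
    case 2
    have "equivalent_gradings G \<Gamma> (integer_mod_group (ord g)) (NF_mod n e (ord g))"
      by (rule equiv[where d' = "\<lambda>j. int j mod int (ord g)"])
        (use NF_mod_eq pow 2 in \<open>auto simp: carrier_integer_mod_group\<close>)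
    then show ?thesis using 2 unfolding NF_gradings_def by blast
  next
    case 3
    have "int j mod int (ord g) = int k mod int (ord g) \<longleftrightarrow> j = k"
      if "j \<in> {1..n}" "k \<in> {1..n}" for j k
    proof (cases "ord g = 0")
      case False
      then have "\<bar>int j - int k\<bar> < int (ord g)" using 3 that by auto
      then show ?thesis
        using dvd_imp_le_int[of "int j - int k" "int (ord g)"] by (auto simp: mod_eq_dvd_iff)
    qed simp
    then have "equivalent_gradings G \<Gamma> integer_group (NF_integer n e)"
      by (intro equiv[where d' = int]) (use NF_integer_eq pow in auto)
    then show ?thesis unfolding NF_gradings_def by blast
  qed
qed

text \<open>For \<open>n\<close> at least 2, the support sizes 1, \<open>n\<close> and
  \<open>i\<close> with \<open>i\<close> strictly between them are all different, so the size
  identifies the entry of the list.\<close>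

lemma NF_gradings_eqI:
  assumes n2: "2 \<le> n" and H: "(H, \<Delta>) \<in> NF_gradings n e" and H': "(H', \<Delta>') \<in> NF_gradings n e"
    and card: "card (support H \<Delta>) = card (support H' \<Delta>')"
  shows "(H, \<Delta>) = (H', \<Delta>')"
  using H
proof (cases rule: NF_gradings_cases)
  case 1
  from H' show ?thesis
    by (cases rule: NF_gradings_cases)
      (use 1 card n2 in \<open>auto simp: support_NF_trivial support_NF_integer support_NF_mod card_image\<close>)
next
  case 2
  from H' show ?thesis
    by (cases rule: NF_gradings_cases)
      (use 2 card n2 in \<open>auto simp: support_NF_trivial support_NF_integer support_NF_mod card_image\<close>)
next
  case (3 i)
  from H' show ?thesis
    by (cases rule: NF_gradings_cases)
      (use 3 card n2 in \<open>auto simp: support_NF_trivial support_NF_integer support_NF_mod card_image\<close>)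
qed

end

end

text \<open>For \<open>n = 1\<close> the gradings (I) and (II) both consist of one component and are
  equivalent; uniqueness is therefore asserted from \<open>n = 2\<close> on.\<close>

theorem theorem13:
  fixes scale :: "complex \<Rightarrow> 'a::ab_group_add \<Rightarrow> 'a" and mul :: "'a \<Rightarrow> 'a \<Rightarrow> 'a"
    and n :: nat and e :: "nat \<Rightarrow> 'a"
    and G :: "'g monoid" and \<Gamma> :: "'g \<Rightarrow> 'a set"
  assumes "leibniz_algebra scale mul"
    and "1 \<le> n"
    and "complex_algebra.null_filiform scale mul n"
    and "complex_algebra.NF_basis scale mul n e"
    and "complex_algebra.abelian_grading scale mul G \<Gamma>"
  shows "(\<forall>(H, \<Delta>) \<in> complex_algebra.NF_gradings scale n e.
            complex_algebra.abelian_grading scale mul H \<Delta>) \<and>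
         (\<exists>(H, \<Delta>) \<in> complex_algebra.NF_gradings scale n e.
            complex_algebra.equivalent_gradings scale mul G \<Gamma> H \<Delta>) \<and>
         (2 \<le> n \<longrightarrow>
            (\<exists>!(H, \<Delta>). (H, \<Delta>) \<in> complex_algebra.NF_gradings scale n e \<and>
               complex_algebra.equivalent_gradings scale mul G \<Gamma> H \<Delta>))"
proof -
  interpret leibniz_algebra scale mul by fact
  note e = assms(4) and n = assms(2)
  have \<Gamma>: "grading G \<Gamma>"
    using assms(5) unfolding abelian_grading_def by blast
  obtain H \<Delta> where H: "(H, \<Delta>) \<in> NF_gradings n e" and eq: "equivalent_gradings G \<Gamma> H \<Delta>"
    using equivalent_to_NF_grading[OF e n \<Gamma>] by blast
  have "\<exists>!(H, \<Delta>). (H, \<Delta>) \<in> NF_gradings n e \<and> equivalent_gradings G \<Gamma> H \<Delta>" if "2 \<le> n"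
  proof (rule ex1I[of _ "(H, \<Delta>)"])
    fix P assume P: "case P of (H, \<Delta>) \<Rightarrow> (H, \<Delta>) \<in> NF_gradings n e \<and> equivalent_gradings G \<Gamma> H \<Delta>"
    obtain H' \<Delta>' where P_eq: "P = (H', \<Delta>')" by (cases P)
    \<comment> \<open>Both listed gradings are equivalent to \<Gamma>, so both supports have the
      size of the support of \<Gamma>.\<close>
    then have "card (support H' \<Delta>') = card (support H \<Delta>)"
      using P equivalent_gradings_card_support[OF eq] by (auto dest: equivalent_gradings_card_support)
    moreover have "(H', \<Delta>') \<in> NF_gradings n e" using P P_eq by simp
    ultimately show "P = (H, \<Delta>)"
      unfolding P_eq by (intro NF_gradings_eqI[OF e n that _ H])
  qed (use H eq in simp)
  with H eq abelian_grading_NF_gradings[OF e n] show ?thesis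
    by blast
qed

end
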